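(* Let $X$ be a Hausdorff space, $D\subset X$ an open set with $\partial D\ne\emptyset$, and $\omega_\cdot^D$ a harmonic measure relative to $D$ which is regular. If $f\in C(\partial D)$ and there exists a $y_0\in\partial D$ such that $f(y_0)=\sup_{y\in\partial D}f(y)$, then $$\sup_{x\in D}\omega_x^D(f)=\max_{y\in\partial D}f(y).$$
   Context: Measures: a measure on a set $Y$ is a map $\omega:2^Y\to[0,\infty]$ with $\omega(\emptyset)=0$ and $\omega(A)\le\sum_k\omega(A_k)$ whenever $A\subseteq\bigcup_{k=1}^\infty A_k$ (an outer measure); measurability is in the sense of Carathéodory; it is Borel if every Borel set is measurable. $\nu\ll\mu$ means $\mu(A)=0\Rightarrow\nu(A)=0$ for every $A\subseteq Y$. Write $\omega(f)=\int f\,\mathrm d\omega$. Pre-harmonic measure: a family of Borel measures $\{\omega^D_x:2^{\partial D}\to[0,1]:x\in D\}$ on $\partial D$ such that for every connected component $V$ of $D$: (1) $\omega_x^D(\partial V)=1$ for all $x\in V$; (2) $\omega^D_x\ll\omega^D_y$ for all $x,y\in V$. Harmonic measure: let $\mathcal F_x=\{E\Delta N: E\subseteq\partial D\text{ Borel},\ N\subseteq\partial D,\ \omega_x^D(N)=0\}$ and $\mathcal F=\bigcap_{x\in D}\mathcal F_x$. Extended real-valued functions measurable w.r.t. $\mathcal F$ are called $\omega_\cdot^D$-measurable. The pre-harmonic measure restricted to $\mathcal F$ is the harmonic measure $\omega_\cdot^D$ relative to $D$. $L(\partial D;\omega_\cdot^D)$ is the set of $\omega_\cdot^D$-measurable $f$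 on $\partial D$ integrable with respect to $\omega_x^D$ for every $x\in D$. A point $y\in\partial D$ is regular if for every $f\in L(\partial D;\omega_\cdot^D)$ continuous at $y$ and every sequence $x_n\to y$ in $D$, $\lim_n\omega_{x_n}^D(f)=f(y)$; $\omega_\cdot^D$ is regular if every $y\in\partial D$ is regular.
   Formalization: Two assumptions are added, without which the claim fails: f is integrable with respect to every harmonic measure at x in D (automatic for bounded f), and some sequence in D converges to y_0 (automatic if X is first countable). *)

theory Defs
  imports "HOL-Analysis.Analysis"
begin

text \<open>Measures on \<open>Y\<close> are outer measures defined on all subsets of \<open>Y\<close>; values of \<open>\<omega>\<close> on sets that are
  not contained in \<open>Y\<close> are irrelevant.\<close>

definition outer_measure_on :: "'a set \<Rightarrow> ('a set \<Rightarrow> ennreal) \<Rightarrow> bool" where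
  "outer_measure_on Y \<omega> \<longleftrightarrow>
     \<omega> {} = 0 \<and>
     (\<forall>A S. A \<subseteq> Y \<and> (\<forall>k::nat. S k \<subseteq> Y) \<and> A \<subseteq> (\<Union>k. S k) \<longrightarrow> \<omega> A \<le> (\<Sum>k. \<omega> (S k)))"

text \<open>\<open>lambda_system Y (Pow Y) \<omega>\<close> is the collection of Caratheodory measurable subsets of \<open>Y\<close>, and
  \<open>sets (restrict_space borel Y)\<close> the Borel sets of the subspace \<open>Y\<close>.\<close>

definition borel_outer_measure_on :: "'a::topological_space set \<Rightarrow> ('a set \<Rightarrow> ennreal) \<Rightarrow> bool" where
  "borel_outer_measure_on Y \<omega> \<longleftrightarrow>
     outer_measure_on Y \<omega> \<and> sets (restrict_space borel Y) \<subseteq> lambda_system Y (Pow Y) \<omega>"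

definition abs_continuous_on :: "'a set \<Rightarrow> ('a set \<Rightarrow> ennreal) \<Rightarrow> ('a set \<Rightarrow> ennreal) \<Rightarrow> bool" where
  "abs_continuous_on Y \<nu> \<mu> \<longleftrightarrow> (\<forall>A\<subseteq>Y. \<mu> A = 0 \<longrightarrow> \<nu> A = 0)"

text \<open>Since \<open>\<omega> x\<close> lives on \<open>frontier D\<close>, the measure of \<open>frontier V\<close> is that of its trace on
  \<open>frontier D\<close>. The trace is all of \<open>frontier V\<close> whenever the component \<open>V\<close> is open, e.g. in locally
  connected spaces.\<close>

definition pre_harmonic_measure ::
  "'a::topological_space set \<Rightarrow> ('a \<Rightarrow> 'a set \<Rightarrow> ennreal) \<Rightarrow> bool" where
  "pre_harmonic_measure D \<omega> \<longleftrightarrow>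
     (\<forall>x\<in>D. borel_outer_measure_on (frontier D) (\<omega> x) \<and> (\<forall>A\<subseteq>frontier D. \<omega> x A \<le> 1)) \<and>
     (\<forall>V\<in>components D.
        (\<forall>x\<in>V. \<omega> x (frontier V \<inter> frontier D) = 1) \<and>
        (\<forall>x\<in>V. \<forall>y\<in>V. abs_continuous_on (frontier D) (\<omega> x) (\<omega> y)))"

definition harmonic_sets_at ::
  "'a::topological_space set \<Rightarrow> ('a \<Rightarrow> 'a set \<Rightarrow> ennreal) \<Rightarrow> 'a \<Rightarrow> 'a set set" where
  "harmonic_sets_at D \<omega> x =
     {sym_diff E N | E N. E \<in> sets (restrict_space borel (frontier D)) \<and>
        N \<subseteq> frontier D \<and> \<omega> x N = 0}"

definition harmonic_sets ::
  "'a::topological_space set \<Rightarrow> ('a \<Rightarrow> 'a set \<Rightarrow> ennreal) \<Rightarrow> 'a set set" where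
  "harmonic_sets D \<omega> = (\<Inter>x\<in>D. harmonic_sets_at D \<omega> x)"

text \<open>The restriction of \<open>\<omega> x\<close> to \<open>harmonic_sets D \<omega>\<close>; the lemmas at the end show that
  \<open>measure_of\<close> really yields this \<open>\<sigma>\<close>-algebra and these values.\<close>

definition harmonic_measure ::
  "'a::topological_space set \<Rightarrow> ('a \<Rightarrow> 'a set \<Rightarrow> ennreal) \<Rightarrow> 'a \<Rightarrow> 'a measure" where
  "harmonic_measure D \<omega> x = measure_of (frontier D) (harmonic_sets D \<omega>) (\<omega> x)"

text \<open>Lebesgue integral of an extended real-valued function. \<open>e2ennreal\<close> truncates negative values
  to 0, so the two terms are the integrals of the positive and of the negative part.\<close>

definition ereal_integrable :: "'a measure \<Rightarrow> ('a \<Rightarrow> ereal) \<Rightarrow> bool" where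
  "ereal_integrable M f \<longleftrightarrow> f \<in> borel_measurable M \<and> (\<integral>\<^sup>+y. e2ennreal \<bar>f y\<bar> \<partial>M) < \<infinity>"

definition ereal_integral :: "'a measure \<Rightarrow> ('a \<Rightarrow> ereal) \<Rightarrow> ereal" where
  "ereal_integral M f =
     enn2ereal (\<integral>\<^sup>+y. e2ennreal (f y) \<partial>M) - enn2ereal (\<integral>\<^sup>+y. e2ennreal (- f y) \<partial>M)"

definition harmonic_L ::
  "'a::topological_space set \<Rightarrow> ('a \<Rightarrow> 'a set \<Rightarrow> ennreal) \<Rightarrow> ('a \<Rightarrow> ereal) set" where
  "harmonic_L D \<omega> = {f. \<forall>x\<in>D. ereal_integrable (harmonic_measure D \<omega> x) f}"

definition regular_point ::
  "'a::t2_space set \<Rightarrow> ('a \<Rightarrow> 'a set \<Rightarrow> ennreal) \<Rightarrow> 'a \<Rightarrow> bool" where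
  "regular_point D \<omega> y \<longleftrightarrow>
     (\<forall>f\<in>harmonic_L D \<omega>. continuous (at y within frontier D) f \<longrightarrow>
        (\<forall>s::nat \<Rightarrow> 'a. (\<forall>n. s n \<in> D) \<and> s \<longlonglongrightarrow> y \<longrightarrow>
           (\<lambda>n. ereal_integral (harmonic_measure D \<omega> (s n)) f) \<longlonglongrightarrow> f y))"

definition regular_harmonic_measure ::
  "'a::t2_space set \<Rightarrow> ('a \<Rightarrow> 'a set \<Rightarrow> ennreal) \<Rightarrow> bool" where
  "regular_harmonic_measure D \<omega> \<longleftrightarrow> (\<forall>y\<in>frontier D. regular_point D \<omega> y)"


lemma outer_measure_onD:
  assumes "outer_measure_on Y \<omega>" "\<And>k::nat. S k \<subseteq> Y" "A \<subseteq> (\<Union>k. S k)"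
  shows "\<omega> A \<le> (\<Sum>k. \<omega> (S k))"
proof -
  have "A \<subseteq> Y" using assms(2,3) by blast
  then show ?thesis
    using assms(1)[unfolded outer_measure_on_def, THEN conjunct2, rule_format, of A S] assms(2,3)
    by simp
qed

lemma outer_measure_on_mono:
  assumes "outer_measure_on Y \<omega>" "A \<subseteq> B" "B \<subseteq> Y"
  shows "\<omega> A \<le> \<omega> B"
proof -
  have "\<omega> A \<le> (\<Sum>k::nat. \<omega> (if k = 0 then B else {}))"
  proof (rule outer_measure_onD[OF assms(1)])
    show "A \<subseteq> (\<Union>k::nat. if k = 0 then B else {})" using assms(2) by fastforce
  qed (use assms(3) in auto)
  also have "\<dots> = (\<Sum>k\<in>{0::nat}. \<omega> (if k = 0 then B else {}))"
    by (intro suminf_finite) (use assms in \<open>auto simp: outer_measure_on_def\<close>)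
  finally show ?thesis by simp
qed

lemma outer_measure_on_space:
  assumes "outer_measure_on Y \<omega>"
  shows "outer_measure_space (Pow Y) \<omega>"
proof -
  have "increasing (Pow Y) \<omega>"
    using outer_measure_on_mono[OF assms] by (auto simp: increasing_def)
  moreover have "countably_subadditive (Pow Y) \<omega>"
    unfolding countably_subadditive_def
  proof (intro allI impI)
    fix A :: "nat \<Rightarrow> 'a set"
    assume "range A \<subseteq> Pow Y"
    then show "\<omega> (\<Union>i. A i) \<le> (\<Sum>i. \<omega> (A i))"
      by (intro outer_measure_onD[OF assms]) auto
  qed
  ultimately show ?thesis
    using assms by (auto simp: outer_measure_space_def outer_measure_on_def positive_def)
qed

lemma outer_measure_on_null_Union:
  assumes om: "outer_measure_on Y \<omega>" and N: "\<And>i::nat. N i \<subseteq> Y" "\<And>i. \<omega> (N i) = 0"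
  shows "\<omega> (\<Union>i. N i) = 0"
proof -
  have "\<omega> (\<Union>i. N i) \<le> (\<Sum>i. \<omega> (N i))"
    by (rule outer_measure_onD[OF om N(1)]) simp
  then show ?thesis using N(2) by simp
qed

lemma harmonic_sets_at_iff:
  "A \<in> harmonic_sets_at D \<omega> x \<longleftrightarrow>
    A \<subseteq> frontier D \<and> (\<exists>E\<in>sets (restrict_space borel (frontier D)). \<omega> x (sym_diff A E) = 0)"
proof
  assume "A \<in> harmonic_sets_at D \<omega> x"
  then obtain E N where *: "A = sym_diff E N" "E \<in> sets (restrict_space borel (frontier D))"
    "N \<subseteq> frontier D" "\<omega> x N = 0" unfolding harmonic_sets_at_def by blast
  have "E \<subseteq> frontier D" using sets.sets_into_space[OF *(2)] by (simp add: space_restrict_space)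
  moreover have "sym_diff A E = N" using *(1) by blast
  ultimately show "A \<subseteq> frontier D \<and> (\<exists>E\<in>sets (restrict_space borel (frontier D)). \<omega> x (sym_diff A E) = 0)"
    using *(1-4) by (intro conjI bexI[of _ E]) auto
next
  assume "A \<subseteq> frontier D \<and> (\<exists>E\<in>sets (restrict_space borel (frontier D)). \<omega> x (sym_diff A E) = 0)"
  then obtain E where *: "A \<subseteq> frontier D" "E \<in> sets (restrict_space borel (frontier D))"
     "\<omega> x (sym_diff A E) = 0" by blast
  have "E \<subseteq> frontier D" using sets.sets_into_space[OF *(2)] by (simp add: space_restrict_space)
  then have sub: "sym_diff A E \<subseteq> frontier D" using *(1) by blast
  have eq: "A = sym_diff E (sym_diff A E)" by blast
  show "A \<in> harmonic_sets_at D \<omega> x"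
    unfolding harmonic_sets_at_def mem_Collect_eq
    by (rule exI[where x = E], rule exI[where x = "sym_diff A E"], intro conjI)
      (rule eq *(2) sub *(3))+
qed

lemma sigma_algebra_harmonic_sets_at:
  assumes "outer_measure_on (frontier D) (\<omega> x)"
  shows "sigma_algebra (frontier D) (harmonic_sets_at D \<omega> x)"
proof -
  let ?B = "restrict_space borel (frontier D)"
  have sp: "space ?B = frontier D" by (simp add: space_restrict_space)
  show ?thesis
    unfolding sigma_algebra_iff2
  proof (intro conjI ballI allI impI)
    show "harmonic_sets_at D \<omega> x \<subseteq> Pow (frontier D)"
      by (auto simp: harmonic_sets_at_iff)
    show "{} \<in> harmonic_sets_at D \<omega> x"
      using assms by (auto simp: harmonic_sets_at_iff outer_measure_on_def intro!: bexI[of _ "{}"])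
  next
    fix A assume "A \<in> harmonic_sets_at D \<omega> x"
    then obtain E where E: "A \<subseteq> frontier D" "E \<in> sets ?B" "\<omega> x (sym_diff A E) = 0"
      by (auto simp: harmonic_sets_at_iff)
    have "E \<subseteq> frontier D" using sets.sets_into_space[OF E(2)] sp by simp
    then have "sym_diff (frontier D - A) (frontier D - E) = sym_diff A E" using E(1) by blast
    moreover have "frontier D - E \<in> sets ?B" using sets.compl_sets[OF E(2)] sp by simp
    ultimately show "frontier D - A \<in> harmonic_sets_at D \<omega> x"
      using E(3) unfolding harmonic_sets_at_iff
      by (intro conjI bexI[of _ "frontier D - E"]) simp_all
  next
    fix A :: "nat \<Rightarrow> 'a set" assume A: "range A \<subseteq> harmonic_sets_at D \<omega> x"
    then have "\<forall>i. A i \<subseteq> frontier D \<and> (\<exists>E\<in>sets ?B. \<omega> x (sym_diff (A i) E) = 0)"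
      unfolding image_subset_iff harmonic_sets_at_iff by blast
    then obtain E where E: "\<And>i. A i \<subseteq> frontier D" "\<And>i. E i \<in> sets ?B"
      "\<And>i. \<omega> x (sym_diff (A i) (E i)) = 0" by metis
    have Esub: "\<And>i. E i \<subseteq> frontier D" using sets.sets_into_space[OF E(2)] sp by simp
    have n: "\<omega> x (\<Union>i. sym_diff (A i) (E i)) = 0"
      by (rule outer_measure_on_null_Union[OF assms]) (use E(3) subsetD[OF E(1)] subsetD[OF Esub] in auto)
    have "\<omega> x (sym_diff (\<Union>i. A i) (\<Union>i. E i)) \<le> \<omega> x (\<Union>i. sym_diff (A i) (E i))"
      by (rule outer_measure_on_mono[OF assms]) (use E(1) Esub in blast)+
    then have z: "\<omega> x (sym_diff (\<Union>i. A i) (\<Union>i. E i)) = 0" using n by simp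
    have bE: "(\<Union>i. E i) \<in> sets ?B" using E(2) by blast
    have sA: "(\<Union>i. A i) \<subseteq> frontier D" using E(1) by blast
    show "(\<Union>i. A i) \<in> harmonic_sets_at D \<omega> x"
      unfolding harmonic_sets_at_iff
      by (rule conjI, rule sA, rule bexI[where x = "\<Union>i. E i"], rule z, rule bE)
  qed
qed

lemma caratheodory_null:
  assumes om: "outer_measure_on Y \<omega>" and "N \<subseteq> Y" "\<omega> N = 0"
  shows "N \<in> lambda_system Y (Pow Y) \<omega>"
proof -
  have "\<omega> (N \<inter> S) + \<omega> ((Y - N) \<inter> S) = \<omega> S" if S: "S \<subseteq> Y" for S
  proof (rule antisym)
    have "\<omega> (N \<inter> S) = 0" using outer_measure_on_mono[OF om, of "N \<inter> S" N] assms by auto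
    moreover have "\<omega> ((Y - N) \<inter> S) \<le> \<omega> S" by (rule outer_measure_on_mono[OF om]) (use S in auto)
    ultimately show "\<omega> (N \<inter> S) + \<omega> ((Y - N) \<inter> S) \<le> \<omega> S" by simp
    let ?T = "\<lambda>k::nat. if k = 0 then N \<inter> S else if k = 1 then (Y - N) \<inter> S else {}"
    have "\<omega> S \<le> (\<Sum>k. \<omega> (?T k))"
    proof (rule outer_measure_onD[OF om])
      show "S \<subseteq> (\<Union>k. ?T k)"
      proof
        fix z assume "z \<in> S"
        then have "z \<in> ?T (if z \<in> N then 0 else 1)" using S by auto
        then show "z \<in> (\<Union>k. ?T k)" by (rule UN_I[OF UNIV_I])
      qed
    qed (use S in auto)
    also have "\<dots> = (\<Sum>k\<in>{0,1::nat}. \<omega> (?T k))"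
      by (intro suminf_finite) (use om in \<open>auto simp: outer_measure_on_def\<close>)
    finally show "\<omega> S \<le> \<omega> (N \<inter> S) + \<omega> ((Y - N) \<inter> S)" by simp
  qed
  then show ?thesis using assms by (auto simp: lambda_system_def)
qed

lemma sigma_algebra_harmonic_sets:
  assumes "pre_harmonic_measure D \<omega>" and "D \<noteq> {}"
  shows "sigma_algebra (frontier D) (harmonic_sets D \<omega>)"
proof -
  have "sigma_algebra (frontier D) (harmonic_sets_at D \<omega> x)" if "x \<in> D" for x
    using assms that
    by (auto simp: pre_harmonic_measure_def borel_outer_measure_on_def
        intro!: sigma_algebra_harmonic_sets_at)
  then have *: "harmonic_sets_at D \<omega> x \<subseteq> Pow (frontier D)" "{} \<in> harmonic_sets_at D \<omega> x"
    "\<And>A. A \<in> harmonic_sets_at D \<omega> x \<Longrightarrow> frontier D - A \<in> harmonic_sets_at D \<omega> x"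
    "\<And>A::nat \<Rightarrow> _. range A \<subseteq> harmonic_sets_at D \<omega> x \<Longrightarrow> (\<Union>i. A i) \<in> harmonic_sets_at D \<omega> x"
    if "x \<in> D" for x
    using that unfolding sigma_algebra_iff2 by simp_all
  show ?thesis
    unfolding sigma_algebra_iff2
  proof (intro conjI ballI allI impI)
    show "harmonic_sets D \<omega> \<subseteq> Pow (frontier D)"
      using *(1) assms(2) unfolding harmonic_sets_def by blast
    show "{} \<in> harmonic_sets D \<omega>"
      using *(2) by (simp add: harmonic_sets_def)
    show "frontier D - A \<in> harmonic_sets D \<omega>" if "A \<in> harmonic_sets D \<omega>" for A
      using *(3) that by (simp add: harmonic_sets_def)
    show "(\<Union>i. A i) \<in> harmonic_sets D \<omega>" if "range A \<subseteq> harmonic_sets D \<omega>" for A :: "nat \<Rightarrow> _"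
      unfolding harmonic_sets_def
    proof (rule INT_I)
      fix x assume "x \<in> D"
      moreover from this have "range A \<subseteq> harmonic_sets_at D \<omega> x"
        using that unfolding harmonic_sets_def by blast
      ultimately show "(\<Union>i. A i) \<in> harmonic_sets_at D \<omega> x" by (rule *(4))
    qed
  qed
qed

lemma space_harmonic_measure:
  assumes "pre_harmonic_measure D \<omega>" and "D \<noteq> {}"
  shows "space (harmonic_measure D \<omega> x) = frontier D"
  using sigma_algebra_harmonic_sets[OF assms]
  by (simp add: harmonic_measure_def space_measure_of_conv)

lemma sets_harmonic_measure:
  assumes "pre_harmonic_measure D \<omega>" and "D \<noteq> {}"
  shows "sets (harmonic_measure D \<omega> x) = harmonic_sets D \<omega>"
  using sigma_algebra_harmonic_sets[OF assms]
  by (simp add: harmonic_measure_def sets_measure_of_conv sigma_algebra.sigma_sets_eq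
      sigma_algebra_iff2)

lemma emeasure_harmonic_measure:
  assumes pre: "pre_harmonic_measure D \<omega>" and x: "x \<in> D" and A: "A \<in> harmonic_sets D \<omega>"
  shows "emeasure (harmonic_measure D \<omega> x) A = \<omega> x A"
proof -
  let ?L = "lambda_system (frontier D) (Pow (frontier D)) (\<omega> x)"
  have om: "outer_measure_on (frontier D) (\<omega> x)"
    and bor: "sets (restrict_space borel (frontier D)) \<subseteq> ?L"
    using pre x by (auto simp: pre_harmonic_measure_def borel_outer_measure_on_def)
  interpret P: sigma_algebra "frontier D" "Pow (frontier D)" by (rule sigma_algebra_Pow)
  have ms: "measure_space (frontier D) ?L (\<omega> x)"
    by (rule P.caratheodory_lemma[OF outer_measure_on_space[OF om]])
  then interpret L: sigma_algebra "frontier D" ?L by (simp add: measure_space_def)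
  have sub: "harmonic_sets D \<omega> \<subseteq> ?L"
  proof
    fix B assume "B \<in> harmonic_sets D \<omega>"
    then have "B \<in> harmonic_sets_at D \<omega> x" using x by (auto simp: harmonic_sets_def)
    then obtain E N where "B = sym_diff E N" "E \<in> sets (restrict_space borel (frontier D))"
      "N \<subseteq> frontier D" "\<omega> x N = 0" unfolding harmonic_sets_at_def by blast
    then show "B \<in> ?L" using bor caratheodory_null[OF om, of N] by auto
  qed
  have sa: "sigma_algebra (frontier D) (harmonic_sets D \<omega>)"
    using sigma_algebra_harmonic_sets pre x by blast
  have "countably_additive (harmonic_sets D \<omega>) (\<omega> x)"
    using ms sub by (auto simp: measure_space_def countably_additive_def)
  moreover have "positive (harmonic_sets D \<omega>) (\<omega> x)"
    using om by (simp add: positive_def outer_measure_on_def)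
  ultimately show ?thesis
    unfolding harmonic_measure_def
    using emeasure_measure_of_sigma[OF sa _ _ A] by blast
qed

end

theory Submission
  imports Defs "HOL-Probability.Probability_Measure"
begin

text \<open>Both inequalities compare with \<open>f y0\<close>, the maximum of \<open>f\<close> on
  the boundary. By \<open>prob_space_harmonic_measure\<close> each harmonic measure has total mass
  one, so integrating \<open>f\<close> against it cannot exceed \<open>f y0\<close>. Conversely,
  regularity at \<open>y0\<close> makes the integrals converge to \<open>f y0\<close> along a
  sequence in \<open>D\<close> tending to \<open>y0\<close>, so their supremum is at least
  \<open>f y0\<close>. Such a sequence is assumed, because in a general Hausdorff space a boundary
  point need not be a sequential limit of points of \<open>D\<close>. The lemma
  \<open>ereal_integral_ereal\<close> reduces the extended real integral of a real function to the
  Bochner integral, for which the bound by a constant is available.\<close>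

lemma ereal_integral_ereal:
  assumes "ereal_integrable M (\<lambda>y. ereal (f y))"
  shows "integrable M f"
    and "ereal_integral M (\<lambda>y. ereal (f y)) = ereal (\<integral>y. f y \<partial>M)"
proof -
  \<comment> \<open>Both conversions send negative reals to 0, so the positive and negative parts
    agree with those used for the Bochner integral.\<close>
  have e: "e2ennreal (ereal r) = ennreal r" for r
    by (simp add: ennreal.rep_eq[symmetric] e2ennreal_def ennreal.abs_eq sup_ereal_def)
  have "(\<lambda>y. real_of_ereal (ereal (f y))) \<in> borel_measurable M"
    using assms unfolding ereal_integrable_def by (intro borel_measurable_real_of_ereal) simp
  then show int: "integrable M f"
    using assms by (intro integrableI_bounded) (simp_all add: ereal_integrable_def e)
  \<comment> \<open>Finiteness of both parts rules out \<infinity> - \<infinity>, so the extended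
    real difference is a difference of reals.\<close>
  then have "(\<integral>\<^sup>+y. ennreal (f y) \<partial>M) \<noteq> \<infinity>" "(\<integral>\<^sup>+y. ennreal (- f y) \<partial>M) \<noteq> \<infinity>"
    by (auto simp: real_integrable_def)
  then obtain p q where "0 \<le> p" "0 \<le> q" "(\<integral>\<^sup>+y. ennreal (f y) \<partial>M) = ennreal p"
      "(\<integral>\<^sup>+y. ennreal (- f y) \<partial>M) = ennreal q"
    by (metis ennreal_cases infinity_ennreal_def)
  then show "ereal_integral M (\<lambda>y. ereal (f y)) = ereal (\<integral>y. f y \<partial>M)"
    by (simp add: ereal_integral_def e real_lebesgue_integral_def[OF int] enn2ereal_ennreal)
qed

text \<open>The component of \<open>D\<close> containing \<open>x\<close> gives mass one to the
  trace of its frontier; monotonicity and the upper bound 1 then force the whole of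
  \<open>frontier D\<close> to have mass one.\<close>

lemma prob_space_harmonic_measure:
  assumes pre: "pre_harmonic_measure D \<omega>" and x: "x \<in> D"
  shows "prob_space (harmonic_measure D \<omega> x)"
proof
  have D: "D \<noteq> {}" using x by blast
  obtain V where V: "V \<in> components D" "x \<in> V"
    using x Union_components[of D] by blast
  have om: "outer_measure_on (frontier D) (\<omega> x)" and le: "\<omega> x (frontier D) \<le> 1"
    using pre x by (auto simp: pre_harmonic_measure_def borel_outer_measure_on_def)
  have "1 = \<omega> x (frontier V \<inter> frontier D)"
    using pre V by (auto simp: pre_harmonic_measure_def)
  also have "\<dots> \<le> \<omega> x (frontier D)"
    by (rule outer_measure_on_mono[OF om]) auto
  finally have "\<omega> x (frontier D) = 1" using le by simp
  moreover have "frontier D \<in> harmonic_sets D \<omega>"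
    using sets.top[of "harmonic_measure D \<omega> x"]
    by (simp add: space_harmonic_measure[OF pre D] sets_harmonic_measure[OF pre D])
  ultimately show "emeasure (harmonic_measure D \<omega> x) (space (harmonic_measure D \<omega> x)) = 1"
    by (simp add: space_harmonic_measure[OF pre D] emeasure_harmonic_measure[OF pre x])
qed

theorem theorem2p7:
  fixes D :: "'a::t2_space set"
    and \<omega> :: "'a \<Rightarrow> 'a set \<Rightarrow> ennreal"
    and f :: "'a \<Rightarrow> real"
    and y0 :: 'a
  assumes "open D"
    and "frontier D \<noteq> {}"
    and "pre_harmonic_measure D \<omega>"
    and "regular_harmonic_measure D \<omega>"
    and "continuous_on (frontier D) f"
    and "(\<lambda>y. ereal (f y)) \<in> harmonic_L D \<omega>"
    and "y0 \<in> frontier D"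
    and "ereal (f y0) = (SUP y\<in>frontier D. ereal (f y))"
    and "\<exists>s::nat \<Rightarrow> 'a. (\<forall>n. s n \<in> D) \<and> s \<longlonglongrightarrow> y0"
  shows "(SUP x\<in>D. ereal_integral (harmonic_measure D \<omega> x) (\<lambda>y. ereal (f y)))
           = ereal (GREATEST v. v \<in> f ` frontier D)"
proof -
  have le: "f y \<le> f y0" if "y \<in> frontier D" for y
    using SUP_upper[OF that, of "\<lambda>y. ereal (f y)"] assms(8) by (metis ereal_less_eq(3))
  have "(GREATEST v. v \<in> f ` frontier D) = f y0"
    by (rule Greatest_equality) (use assms(7) le in auto)
  moreover have "(SUP x\<in>D. ereal_integral (harmonic_measure D \<omega> x) (\<lambda>y. ereal (f y))) = ereal (f y0)"
    (is "(SUP x\<in>D. ?I x) = _")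
  proof (rule antisym)
    show "(SUP x\<in>D. ?I x) \<le> ereal (f y0)"
    proof (rule SUP_least)
      fix x assume x: "x \<in> D"
      then have int: "ereal_integrable (harmonic_measure D \<omega> x) (\<lambda>y. ereal (f y))"
        using assms(6) by (simp add: harmonic_L_def)
      interpret prob_space "harmonic_measure D \<omega> x"
        by (rule prob_space_harmonic_measure[OF assms(3) x])
      \<comment> \<open>Since the mass is exactly one, the constant \<open>f y0\<close> integrates
        to itself whatever its sign.\<close>
      have "(\<integral>y. f y \<partial>harmonic_measure D \<omega> x) \<le> f y0"
        by (rule integral_le_const[OF ereal_integral_ereal(1)[OF int]], rule AE_I2)
          (use x le space_harmonic_measure[OF assms(3)] in auto)
      then show "?I x \<le> ereal (f y0)"
        by (simp add: ereal_integral_ereal(2)[OF int])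
    qed
    obtain s :: "nat \<Rightarrow> 'a" where s: "\<And>n. s n \<in> D" "s \<longlonglongrightarrow> y0"
      using assms(9) by blast
    \<comment> \<open>Regularity is stated for extended real-valued functions, so continuity is
      carried over along the embedding \<open>ereal\<close>.\<close>
    have "continuous (at y0 within frontier D) (\<lambda>y. ereal (f y))"
      using assms(5,7) by (auto simp: continuous_on_eq_continuous_within continuous_within)
    then have "(\<lambda>n. ?I (s n)) \<longlonglongrightarrow> ereal (f y0)"
      using assms(4,6,7) s unfolding regular_harmonic_measure_def regular_point_def by blast
    then show "ereal (f y0) \<le> (SUP x\<in>D. ?I x)"
      by (rule LIMSEQ_le_const2) (intro exI allI impI SUP_upper s(1))
  qed
  ultimately show ?thesis by simp
qed

end
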